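(* Let $(L_-,L_+)$ be a couple of Lagrangians, $L_\pm:\mathbb{R}^3\times(0,\infty)\to\mathbb{R}$, $(x,v,t,\xi)\mapsto L_\pm(x,v,t,\xi)$. Then $(L_-,L_+)$ is a null couple of Lagrangians if and only if there exist two functions $f:\mathbb{R}^2\times(0,\infty)\to\mathbb{R}$ and $g:\mathbb{R}\times(0,\infty)\to\mathbb{R}$ such that for every $\boldsymbol{T}\in\mathbb{T}$, every $\boldsymbol{Q}\in\mathbb{R}^{N+1}$ and every $p=1,\dots,N$, $$L_-\big(Q_p,(\Delta_-\boldsymbol{Q})_p,t_p,h\big)+L_+\big(Q_{p-1},(-\Delta_+\boldsymbol{Q})_{p-1},t_{p-1},h\big)=\Delta_-\big(f(\boldsymbol{Q},\boldsymbol{T},h)\big)_p+g(t_p,h),$$ where $f(\boldsymbol{Q},\boldsymbol{T},h)$ denotes the sequence $(f(Q_p,t_p,h))_{p=0,\dots,N}$.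
   Context: $\mathbb{T}$ is the set of all $\boldsymbol{T}=(t_p)_{p=0,\dots,N}\in\mathbb{R}^{N+1}$, with $N\ge 4$ an integer, for which there is $h>0$ with $t_{i+1}-t_i=h$ for all $i=0,\dots,N-1$. Both $N$ and $h$ depend on $\boldsymbol{T}$. Discrete derivatives: for a finite sequence $\boldsymbol{F}$, $(\Delta_-\boldsymbol{F})_p=\frac{F_p-F_{p-1}}{h}$ and $(\Delta_+\boldsymbol{F})_p=\frac{F_p-F_{p+1}}{h}$, for every index $p$ for which the entries involved are defined. Vectors $\boldsymbol{Q}\in\mathbb{R}^{N+1}$ are indexed by $0,\dots,N$. For a couple of Lagrangians $(L_-,L_+)$ and $\boldsymbol{T}\in\mathbb{T}$, the second order discrete Euler-Lagrange equation for $\boldsymbol{Q}\in\mathbb{R}^{N+1}$ is: for all $p=1,\dots,N-1$, $$\frac{\partial L_-}{\partial x}(\ast_p)+\frac{\partial L_+}{\partial x}(\ast\ast_p)+\Delta_+\Big(\frac{\partial L_-}{\partial v}(\ast)\Big)_p-\Delta_-\Big(\frac{\partial L_+}{\partial v}(\ast\ast)\Big)_p=0,$$ where $\ast_p:=(Q_p,(\Delta_-\boldsymbol{Q})_p,t_p,h)$ for $p=1,\dots,N$, $\ast\ast_p:=(Q_p,(-\Delta_+\boldsymbol{Q})_p,t_p,h)$ for $p=0,\dots,N-1$, and $\frac{\partial L_-}{\partial v}(\ast)$, $\frac{\partial L_+}{\partial v}(\ast\ast)$ denote the corresponding sequences. $(L_-,L_+)$ is a null couple of Lagrangians if, for every $\boldsymbol{T}\in\mathbb{T}$,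 every $\boldsymbol{Q}\in\mathbb{R}^{N+1}$ is a solution of this equation. Standing assumption: $L_-$, $L_+$ are sufficiently smooth (for definiteness, $C^\infty$). *)

theory Defs
  imports "HOL-Analysis.Analysis"
begin

text \<open>Differentiability classes on an open set \<open>S\<close>. All derivatives are taken with respect to the
  full neighbourhood filter, so the definitions are meant for open \<open>S\<close> only.\<close>

fun Ck_on :: "nat \<Rightarrow> 'a::real_normed_vector set \<Rightarrow> ('a \<Rightarrow> real) \<Rightarrow> bool" where
  "Ck_on 0 S f \<longleftrightarrow> continuous_on S f"
| "Ck_on (Suc k) S f \<longleftrightarrow>
     (\<forall>x\<in>S. f differentiable (at x)) \<and> (\<forall>w. Ck_on k S (\<lambda>x. frechet_derivative f (at x) w))"

definition Cinf_on :: "'a::real_normed_vector set \<Rightarrow> ('a \<Rightarrow> real) \<Rightarrow> bool" where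
  "Cinf_on S f \<longleftrightarrow> (\<forall>k. Ck_on k S f)"

text \<open>A Lagrangian \<open>L (x, v, t, \<xi>)\<close> lives on \<open>\<real>\<^sup>3 \<times> (0, \<infinity>)\<close>. It is modelled by a total function
  whose values for \<open>\<xi> \<le> 0\<close> are irrelevant.\<close>

type_synonym lagrangian = "real \<times> real \<times> real \<times> real \<Rightarrow> real"

definition lagr_dom :: "(real \<times> real \<times> real \<times> real) set" where
  "lagr_dom = UNIV \<times> UNIV \<times> UNIV \<times> {0<..}"

definition partial_x :: "lagrangian \<Rightarrow> lagrangian" where
  "partial_x L = (\<lambda>(x, v, t, \<xi>). deriv (\<lambda>y. L (y, v, t, \<xi>)) x)"

definition partial_v :: "lagrangian \<Rightarrow> lagrangian" where
  "partial_v L = (\<lambda>(x, v, t, \<xi>). deriv (\<lambda>w. L (x, w, t, \<xi>)) v)"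

text \<open>A vector of \<open>\<real>\<^bsup>N+1\<^esup>\<close> is represented by a sequence \<open>nat \<Rightarrow> real\<close> of which only the entries
  \<open>0, \<dots>, N\<close> are ever used. The triple \<open>(N, h, T)\<close> encodes an element of \<open>\<bbbT>\<close> together with the
  \<open>N\<close> and \<open>h\<close> that it determines.\<close>

definition time_grid :: "nat \<Rightarrow> real \<Rightarrow> (nat \<Rightarrow> real) \<Rightarrow> bool" where
  "time_grid N h T \<longleftrightarrow> N \<ge> 4 \<and> h > 0 \<and> (\<forall>i<N. T (i + 1) - T i = h)"

text \<open>The entry of \<open>delta_minus\<close> at index \<open>0\<close> is a junk value, as \<open>0 - 1 = 0\<close> on \<open>nat\<close>;
  it is never used. Note the sign of \<open>delta_plus\<close>: it is minus the forward difference quotient.\<close>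

definition delta_minus :: "real \<Rightarrow> (nat \<Rightarrow> real) \<Rightarrow> nat \<Rightarrow> real" where
  "delta_minus h F p = (F p - F (p - 1)) / h"

definition delta_plus :: "real \<Rightarrow> (nat \<Rightarrow> real) \<Rightarrow> nat \<Rightarrow> real" where
  "delta_plus h F p = (F p - F (p + 1)) / h"

text \<open>The arguments \<open>\<ast>\<^sub>p\<close> (for \<open>p = 1, \<dots>, N\<close>) and \<open>\<ast>\<ast>\<^sub>p\<close> (for \<open>p = 0, \<dots>, N - 1\<close>).\<close>

definition arg_minus :: "real \<Rightarrow> (nat \<Rightarrow> real) \<Rightarrow> (nat \<Rightarrow> real) \<Rightarrow> nat \<Rightarrow> real \<times> real \<times> real \<times> real" where
  "arg_minus h T Q p = (Q p, delta_minus h Q p, T p, h)"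

definition arg_plus :: "real \<Rightarrow> (nat \<Rightarrow> real) \<Rightarrow> (nat \<Rightarrow> real) \<Rightarrow> nat \<Rightarrow> real \<times> real \<times> real \<times> real" where
  "arg_plus h T Q p = (Q p, - delta_plus h Q p, T p, h)"

definition discrete_EL ::
  "lagrangian \<Rightarrow> lagrangian \<Rightarrow> nat \<Rightarrow> real \<Rightarrow> (nat \<Rightarrow> real) \<Rightarrow> (nat \<Rightarrow> real) \<Rightarrow> bool" where
  "discrete_EL Lm Lp N h T Q \<longleftrightarrow>
     (\<forall>p\<in>{1..N-1}.
        partial_x Lm (arg_minus h T Q p) + partial_x Lp (arg_plus h T Q p)
        + delta_plus h (\<lambda>q. partial_v Lm (arg_minus h T Q q)) p
        - delta_minus h (\<lambda>q. partial_v Lp (arg_plus h T Q q)) p = 0)"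

definition null_couple :: "lagrangian \<Rightarrow> lagrangian \<Rightarrow> bool" where
  "null_couple Lm Lp \<longleftrightarrow> (\<forall>N h T. time_grid N h T \<longrightarrow> (\<forall>Q. discrete_EL Lm Lp N h T Q))"

end

theory Submission
  imports Defs
begin

text \<open>The two Lagrangians only enter through the cell action
  \<open>S(a, b, t) = L\<^sub>-(b, (b - a)/h, t, h) + L\<^sub>+(a, (b - a)/h, t - h, h)\<close>, and the Euler-Lagrange
  expression at \<open>p\<close> is the derivative of \<open>S(Q\<^bsub>p-1\<^esub>, y, t\<^sub>p) + S(y, Q\<^bsub>p+1\<^esub>, t\<^sub>p + h)\<close> at \<open>y = Q\<^sub>p\<close>.
  Hence the couple is null iff this two-cell action does not depend on the middle point. Replacing
  the middle point by \<open>0\<close> and taking the right end point \<open>0\<close> gives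
  \<open>S(a, b, t) = S(a, 0, t) - S(b, 0, t + h) + S(0, 0, t + h)\<close>, which is the required form with
  \<open>f(x, t, h) = - h S(x, 0, t + h)\<close>. Conversely, for \<open>S\<close> of that form the two contributions of
  \<open>f\<close> at the middle point cancel, without any regularity of \<open>f\<close> or \<open>g\<close>.\<close>

lemma Cinf_on_imp_differentiable:
  assumes "Cinf_on S f" and "x \<in> S"
  shows "f differentiable (at x)"
  using assms Ck_on.simps(2)[of 0 S f] unfolding Cinf_on_def by blast

text \<open>The partial derivatives are the values of the total derivative at the first two unit
  vectors, so its linearity gives the chain rule in this form.\<close>

lemma has_real_derivative_lagrangian:
  fixes L :: lagrangian
  assumes L: "L differentiable (at (u s, w s, t, \<xi>))"
    and u: "(u has_real_derivative u') (at s)" and w: "(w has_real_derivative w') (at s)"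
  shows "((\<lambda>y. L (u y, w y, t, \<xi>)) has_real_derivative
    u' * partial_x L (u s, w s, t, \<xi>) + w' * partial_v L (u s, w s, t, \<xi>)) (at s)"
proof -
  obtain D where D: "(L has_derivative D) (at (u s, w s, t, \<xi>))"
    using L by (auto simp: differentiable_def)
  then interpret D: linear D
    by (rule has_derivative_linear)
  \<comment> \<open>The base point \<open>r\<close> is kept apart from \<open>s\<close>: besides the
    curve \<open>(u, w)\<close> at \<open>s\<close>, the two coordinate lines are needed, at
    \<open>u s\<close> and at \<open>w s\<close>.\<close>
  have chain: "((\<lambda>y. L (a y, b y, t, \<xi>)) has_real_derivative D (a', b', 0, 0)) (at r)"
    if "(a has_real_derivative a') (at r)" "(b has_real_derivative b') (at r)"
      "a r = u s" "b r = w s" for a b a' b' r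
  proof -
    have "((\<lambda>y. (a y, b y, t, \<xi>)) has_derivative (\<lambda>y. (y * a', y * b', 0, 0))) (at r)"
      using that(1,2) by (auto intro!: derivative_eq_intros simp: has_field_derivative_def mult.commute zero_prod_def)
    moreover have "(L has_derivative D) (at (a r, b r, t, \<xi>))"
      using D that by simp
    ultimately have "((\<lambda>y. L (a y, b y, t, \<xi>)) has_derivative (\<lambda>y. D (y * a', y * b', 0, 0))) (at r)"
      by (rule has_derivative_compose)
    moreover have "D (y * a', y * b', 0, 0) = D (a', b', 0, 0) * y" for y
      using D.scaleR[of y "(a', b', 0, 0)"] by simp
    ultimately show ?thesis
      by (simp add: has_field_derivative_def)
  qed
  have "partial_x L (u s, w s, t, \<xi>) = D (1, 0, 0, 0)"
    unfolding partial_x_def prod.case by (intro DERIV_imp_deriv chain) (auto intro!: derivative_eq_intros)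
  moreover have "partial_v L (u s, w s, t, \<xi>) = D (0, 1, 0, 0)"
    unfolding partial_v_def prod.case by (intro DERIV_imp_deriv chain) (auto intro!: derivative_eq_intros)
  moreover have "D (u', w', 0, 0) = u' * D (1, 0, 0, 0) + w' * D (0, 1, 0, 0)"
    using D.add[of "u' *\<^sub>R (1, 0, 0, 0)" "w' *\<^sub>R (0, 1, 0, 0)"]
      D.scaleR[of u' "(1, 0, 0, 0)"] D.scaleR[of w' "(0, 1, 0, 0)"] by simp
  ultimately show ?thesis
    using chain[OF u w] by simp
qed

definition cell_action :: "lagrangian \<Rightarrow> lagrangian \<Rightarrow> real \<Rightarrow> real \<Rightarrow> real \<Rightarrow> real \<Rightarrow> real" where
  "cell_action Lm Lp h t a b = Lm (b, (b - a) / h, t, h) + Lp (a, (b - a) / h, t - h, h)"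

text \<open>Here \<open>t\<close> is the time of the middle point \<open>b\<close>, with
  \<open>a\<close> at \<open>t - h\<close> and \<open>c\<close> at \<open>t + h\<close>; in
  \<open>cell_action\<close> it is the time of the right end point.\<close>

definition EL_expr :: "lagrangian \<Rightarrow> lagrangian \<Rightarrow> real \<Rightarrow> real \<Rightarrow> real \<Rightarrow> real \<Rightarrow> real \<Rightarrow> real" where
  "EL_expr Lm Lp h t a b c =
     partial_x Lm (b, (b - a) / h, t, h) + partial_x Lp (b, (c - b) / h, t, h)
     + (partial_v Lm (b, (b - a) / h, t, h) - partial_v Lm (c, (c - b) / h, t + h, h)) / h
     - (partial_v Lp (b, (c - b) / h, t, h) - partial_v Lp (a, (b - a) / h, t - h, h)) / h"

lemma time_grid_succ:
  assumes "time_grid N h T" and "i < N"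
  shows "T (Suc i) = T i + h"
  using assms by (auto simp: time_grid_def algebra_simps)

lemma discrete_EL_iff:
  assumes T: "time_grid N h T"
  shows "discrete_EL Lm Lp N h T Q \<longleftrightarrow>
    (\<forall>p\<in>{1..N-1}. EL_expr Lm Lp h (T p) (Q (p - 1)) (Q p) (Q (p + 1)) = 0)"
proof -
  have N: "N \<ge> 4"
    using T by (simp add: time_grid_def)
  show ?thesis
    unfolding discrete_EL_def
  proof (intro ball_cong refl)
    fix p
    assume p: "p \<in> {1..N-1}"
    \<comment> \<open>Since \<open>p\<close> is positive, the truncated \<open>p - 1\<close> in
      \<open>delta_minus\<close> is the true predecessor.\<close>
    then obtain q where q: "p = Suc q"
      by (cases p) auto
    have "T q = T p - h" "T (Suc p) = T p + h"
      using p q N time_grid_succ[OF T, of p] time_grid_succ[OF T, of q] by auto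
    then show "(partial_x Lm (arg_minus h T Q p) + partial_x Lp (arg_plus h T Q p)
        + delta_plus h (\<lambda>q. partial_v Lm (arg_minus h T Q q)) p
        - delta_minus h (\<lambda>q. partial_v Lp (arg_plus h T Q q)) p = 0)
      = (EL_expr Lm Lp h (T p) (Q (p - 1)) (Q p) (Q (p + 1)) = 0)"
      unfolding q by (simp add: EL_expr_def arg_minus_def arg_plus_def delta_minus_def
          delta_plus_def minus_divide_left)
  qed
qed

text \<open>Any time and any three neighbouring values occur around index 1 of some grid, so grids
  can be traded for free real variables.\<close>

lemma null_couple_iff_EL_expr:
  "null_couple Lm Lp \<longleftrightarrow> (\<forall>h>0. \<forall>t a b c. EL_expr Lm Lp h t a b c = 0)"
proof
  assume null: "null_couple Lm Lp"
  show "\<forall>h>0. \<forall>t a b c. EL_expr Lm Lp h t a b c = 0"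
  proof (intro allI impI)
    fix h t a b c :: real
    assume "h > 0"
    \<comment> \<open>The shift by 1 puts \<open>t\<close> at the first interior index.\<close>
    define T where "T i = t + (real i - 1) * h" for i
    define Q where "Q i = (if i = 0 then a else if i = 1 then b else c)" for i :: nat
    have T: "time_grid 4 h T"
      using \<open>h > 0\<close> by (simp add: time_grid_def T_def algebra_simps)
    then have "discrete_EL Lm Lp 4 h T Q"
      using null by (simp add: null_couple_def)
    then have "EL_expr Lm Lp h (T 1) (Q (1 - 1)) (Q 1) (Q (1 + 1)) = 0"
      unfolding discrete_EL_iff[OF T] by (rule bspec) simp
    then show "EL_expr Lm Lp h t a b c = 0"
      by (simp add: T_def Q_def)
  qed
next
  assume "\<forall>h>0. \<forall>t a b c. EL_expr Lm Lp h t a b c = 0"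
  then show "null_couple Lm Lp"
    unfolding null_couple_def by (metis discrete_EL_iff time_grid_def)
qed

lemma two_cell_action_has_derivative:
  assumes "Cinf_on lagr_dom Lm" and "Cinf_on lagr_dom Lp" and "h > 0"
  shows "((\<lambda>y. cell_action Lm Lp h t a y + cell_action Lm Lp h (t + h) y c)
    has_real_derivative EL_expr Lm Lp h t a b c) (at b)"
proof -
  have "Lm differentiable (at (x, v, r, h))" "Lp differentiable (at (x, v, r, h))" for x v r
    using assms by (auto intro!: Cinf_on_imp_differentiable simp: lagr_dom_def)
  note L = has_real_derivative_lagrangian[OF this(1)] has_real_derivative_lagrangian[OF this(2)]
  have 1: "((\<lambda>y. (y - a) / h) has_real_derivative 1 / h) (at b)"
    and 2: "((\<lambda>y. (c - y) / h) has_real_derivative - 1 / h) (at b)"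
    using \<open>h > 0\<close> by (auto intro!: derivative_eq_intros)
  \<comment> \<open>The factors 0 belong to the Lagrangians evaluated at the fixed points
    \<open>a\<close> and \<open>c\<close>, where only the velocity depends on
    \<open>y\<close>.\<close>
  have "((\<lambda>y. cell_action Lm Lp h t a y + cell_action Lm Lp h (t + h) y c) has_real_derivative
    (1 * partial_x Lm (b, (b - a) / h, t, h) + 1 / h * partial_v Lm (b, (b - a) / h, t, h))
    + (0 * partial_x Lp (a, (b - a) / h, t - h, h) + 1 / h * partial_v Lp (a, (b - a) / h, t - h, h))
    + ((0 * partial_x Lm (c, (c - b) / h, t + h, h) + - 1 / h * partial_v Lm (c, (c - b) / h, t + h, h))
    + (1 * partial_x Lp (b, (c - b) / h, t + h - h, h) + - 1 / h * partial_v Lp (b, (c - b) / h, t + h - h, h))))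
    (at b)"
    unfolding cell_action_def by (intro DERIV_add L 1 2 DERIV_ident DERIV_const)
  then show ?thesis
    by (simp add: EL_expr_def diff_divide_distrib algebra_simps)
qed

text \<open>For fixed end points, a function of the middle point on the whole real line is constant
  iff its derivative vanishes everywhere.\<close>

lemma null_couple_iff_two_cell_action:
  assumes "Cinf_on lagr_dom Lm" and "Cinf_on lagr_dom Lp"
  shows "null_couple Lm Lp \<longleftrightarrow>
    (\<forall>h>0. \<forall>t a c b b'. cell_action Lm Lp h t a b + cell_action Lm Lp h (t + h) b c
       = cell_action Lm Lp h t a b' + cell_action Lm Lp h (t + h) b' c)"
    (is "_ \<longleftrightarrow> (\<forall>h>0. \<forall>t a c b b'. ?A h t a c b = ?A h t a c b')")
proof -
  have deriv: "(?A h t a c has_real_derivative EL_expr Lm Lp h t a b c) (at b)"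
    if "h > 0" for h t a b c
    using two_cell_action_has_derivative[OF assms that] .
  have const_iff: "(\<forall>b. EL_expr Lm Lp h t a b c = 0) \<longleftrightarrow> (\<forall>b b'. ?A h t a c b = ?A h t a c b')"
    if "h > 0" for h t a c
  proof
    assume "\<forall>b. EL_expr Lm Lp h t a b c = 0"
    then have "\<forall>b. (?A h t a c has_real_derivative 0) (at b)"
      using deriv[OF that] by metis
    then show "\<forall>b b'. ?A h t a c b = ?A h t a c b'"
      using DERIV_isconst_all by blast
  next
    assume "\<forall>b b'. ?A h t a c b = ?A h t a c b'"
    then have "?A h t a c = (\<lambda>_. ?A h t a c 0)"
      by blast
    then show "\<forall>b. EL_expr Lm Lp h t a b c = 0"
      using deriv[OF that] DERIV_const DERIV_unique by metis
  qed
  have "null_couple Lm Lp \<longleftrightarrow> (\<forall>h>0. \<forall>t a c b. EL_expr Lm Lp h t a b c = 0)"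
    unfolding null_couple_iff_EL_expr by blast
  also have "\<dots> \<longleftrightarrow> (\<forall>h>0. \<forall>t a c b b'. ?A h t a c b = ?A h t a c b')"
    by (intro all_cong1 imp_cong refl const_iff)
  finally show ?thesis .
qed

text \<open>Both Lagrangians see the same velocity on the cell from \<open>p - 1\<close> to
  \<open>p\<close>.\<close>

lemma cell_action_grid:
  assumes T: "time_grid N h T" and p: "p \<in> {1..N}"
  shows "Lm (Q p, delta_minus h Q p, T p, h)
      + Lp (Q (p - 1), - delta_plus h Q (p - 1), T (p - 1), h)
    = cell_action Lm Lp h (T p) (Q (p - 1)) (Q p)"
proof -
  have "- delta_plus h Q (p - 1) = (Q p - Q (p - 1)) / h" "T (p - 1) = T p - h"
    using p time_grid_succ[OF T, of "p - 1"] by (auto simp: delta_plus_def minus_divide_left)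
  then show ?thesis
    by (simp add: cell_action_def delta_minus_def)
qed

theorem theorem17:
  fixes Lm Lp :: "real \<times> real \<times> real \<times> real \<Rightarrow> real"
  assumes "Cinf_on lagr_dom Lm" and "Cinf_on lagr_dom Lp"
  shows "null_couple Lm Lp \<longleftrightarrow>
    (\<exists>(f :: real \<times> real \<times> real \<Rightarrow> real) (g :: real \<times> real \<Rightarrow> real).
       \<forall>N h T. time_grid N h T \<longrightarrow>
         (\<forall>Q. \<forall>p\<in>{1..N}.
            Lm (Q p, delta_minus h Q p, T p, h)
            + Lp (Q (p - 1), - delta_plus h Q (p - 1), T (p - 1), h)
            = delta_minus h (\<lambda>q. f (Q q, T q, h)) p + g (T p, h)))"
    (is "_ \<longleftrightarrow> (\<exists>f g. ?R f g)")
proof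
  let ?S = "cell_action Lm Lp"
  assume "null_couple Lm Lp"
  then have S: "?S h t a b + ?S h (t + h) b c = ?S h t a b' + ?S h (t + h) b' c"
    if "h > 0" for h t a b c b'
    using that null_couple_iff_two_cell_action[OF assms] by blast
  \<comment> \<open>In \<open>f\<close> the point \<open>x\<close> at time \<open>t\<close> is the
    left end of a cell, whose action carries the time \<open>t + h\<close> of its right end.\<close>
  define f where "f = (\<lambda>(x, t, h). - h * ?S h (t + h) x 0)"
  define g where "g = (\<lambda>(t, h). ?S h (t + h) 0 0)"
  have "?R f g"
  proof (intro allI impI ballI)
    fix N h T Q p
    assume T: "time_grid N h T" and p: "p \<in> {1..N}"
    then have "h > 0"
      by (simp add: time_grid_def)
    have "T (p - 1) + h = T p"
      using p time_grid_succ[OF T, of "p - 1"] by auto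
    then have "delta_minus h (\<lambda>q. f (Q q, T q, h)) p = ?S h (T p) (Q (p - 1)) 0 - ?S h (T p + h) (Q p) 0"
      using \<open>h > 0\<close> by (simp add: delta_minus_def f_def diff_divide_distrib add.commute)
    then show "Lm (Q p, delta_minus h Q p, T p, h)
        + Lp (Q (p - 1), - delta_plus h Q (p - 1), T (p - 1), h)
        = delta_minus h (\<lambda>q. f (Q q, T q, h)) p + g (T p, h)"
      unfolding cell_action_grid[OF T p] using S[OF \<open>h > 0\<close>, of "T p" "Q (p - 1)" "Q p" 0 0]
      by (simp add: g_def)
  qed
  then show "\<exists>f g. ?R f g"
    by blast
next
  let ?S = "cell_action Lm Lp"
  assume "\<exists>f g. ?R f g"
  then obtain f g where fg: "?R f g"
    by blast
  \<comment> \<open>As \<open>f\<close> and \<open>g\<close> do not depend on the grid, reading the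
    identity at \<open>p = 1\<close> of one grid for each \<open>h\<close>, \<open>t\<close>,
    \<open>a\<close>, \<open>b\<close> suffices.\<close>
  have S: "?S h t a b = (f (b, t, h) - f (a, t - h, h)) / h + g (t, h)" if "h > 0" for h t a b
  proof -
    define T where "T i = t + (real i - 1) * h" for i
    define Q where "Q i = (if i = 0 then a else b)" for i :: nat
    have T: "time_grid 4 h T"
      using that by (simp add: time_grid_def T_def algebra_simps)
    have p: "1 \<in> {1..4::nat}"
      by simp
    have "?S h (T 1) (Q (1 - 1)) (Q 1) = delta_minus h (\<lambda>q. f (Q q, T q, h)) 1 + g (T 1, h)"
      unfolding cell_action_grid[OF T p, symmetric] using fg[rule_format, OF T p] .
    then show ?thesis
      by (simp add: delta_minus_def T_def Q_def)
  qed
  show "null_couple Lm Lp"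
    unfolding null_couple_iff_two_cell_action[OF assms] by (auto simp: S diff_divide_distrib)
qed

end
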